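(* Let $A$ and $B$ be strictly positive operators on a Hilbert space $H$ such that $uA\le B\le vA$ for real numbers $u,v>0$, and let $p,q\in(0,1]$. If either (i) $u\ge1$ and $p\le q\le\frac12$, or (ii) $v\le1$ and $\frac12\le p\le q\le1$, then $$\frac{A\sharp_pB-A!_pB}{p}+p\,A^{1/2}\left(\log A^{-1/2}BA^{-1/2}\right)^2A^{1/2}\ \le\ \frac{A\sharp_qB-A!_qB}{q}+q\,A^{1/2}\left(\log A^{-1/2}BA^{-1/2}\right)^2A^{1/2}.$$
   Context: An operator $A\in B(H)$ (bounded linear operators on a Hilbert space $H$) is strictly positive, $A>0$, if $A\ge 0$ and $A$ is invertible. For self-adjoint $X,Y$, $X\le Y$ means $Y-X$ is positive semidefinite. For $A,B>0$ and $p\in[0,1]$: the $p$-weighted geometric operator mean is $A\sharp_pB=A^{1/2}(A^{-1/2}BA^{-1/2})^pA^{1/2}$, and the $p$-weighted harmonic operator mean is $A!_pB=\{(1-p)A^{-1}+pB^{-1}\}^{-1}$. The expression $\log A^{-1/2}BA^{-1/2}$ means $\log(A^{-1/2}BA^{-1/2})$, taken by functional calculus. *)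

theory Defs
  imports "HOL-Analysis.Analysis" "HOL-Computational_Algebra.Polynomial"
begin

(* Complex Hilbert spaces. Norm, metric and topology are those of the underlying real Hilbert
   space, whose inner product is the real part of the complex one. The complex inner product
   is conjugate-linear in its first argument. *)
class chilbert_space = real_inner + banach +
  fixes scaleC :: "complex \<Rightarrow> 'a \<Rightarrow> 'a"  (infixr \<open>*\<^sub>C\<close> 75)
    and cinner :: "'a \<Rightarrow> 'a \<Rightarrow> complex"
  assumes scaleC_add_right: "c *\<^sub>C (x + y) = c *\<^sub>C x + c *\<^sub>C y"
    and scaleC_add_left: "(c + d) *\<^sub>C x = c *\<^sub>C x + d *\<^sub>C x"
    and scaleC_scaleC: "c *\<^sub>C (d *\<^sub>C x) = (c * d) *\<^sub>C x"
    and scaleC_of_real: "complex_of_real r *\<^sub>C x = r *\<^sub>R x"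
    and cinner_add_right: "cinner x (y + z) = cinner x y + cinner x z"
    and cinner_scaleC_right: "cinner x (c *\<^sub>C y) = c * cinner x y"
    and cinner_commute: "cinner x y = cnj (cinner y x)"
    and inner_eq_Re_cinner: "inner x y = Re (cinner x y)"

instantiation complex :: chilbert_space
begin
definition scaleC_complex :: "complex \<Rightarrow> complex \<Rightarrow> complex"
  where "scaleC_complex c x = c * x"
definition cinner_complex :: "complex \<Rightarrow> complex \<Rightarrow> complex"
  where "cinner_complex x y = cnj x * y"
instance
  by standard
    (auto simp: scaleC_complex_def cinner_complex_def algebra_simps scaleR_conv_of_real
       inner_complex_def)
end

(* The library type of bounded linear maps is real-linear; B(H) consists of its
   complex-linear members. *)
definition bounded_ops :: "('h::chilbert_space \<Rightarrow>\<^sub>L 'h) set"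
  where "bounded_ops = {T. \<forall>c x. blinfun_apply T (c *\<^sub>C x) = c *\<^sub>C blinfun_apply T x}"

definition self_adjoint :: "('h::chilbert_space \<Rightarrow>\<^sub>L 'h) \<Rightarrow> bool"
  where "self_adjoint T \<longleftrightarrow> T \<in> bounded_ops \<and>
    (\<forall>x y. cinner (blinfun_apply T x) y = cinner x (blinfun_apply T y))"

definition positive_op :: "('h::chilbert_space \<Rightarrow>\<^sub>L 'h) \<Rightarrow> bool"
  where "positive_op T \<longleftrightarrow> self_adjoint T \<and> (\<forall>x. 0 \<le> Re (cinner x (blinfun_apply T x)))"

definition op_le :: "('h::chilbert_space \<Rightarrow>\<^sub>L 'h) \<Rightarrow> ('h \<Rightarrow>\<^sub>L 'h) \<Rightarrow> bool"
  (infix \<open>\<le>\<^sub>o\<^sub>p\<close> 50)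
  where "X \<le>\<^sub>o\<^sub>p Y \<longleftrightarrow> self_adjoint X \<and> self_adjoint Y \<and> positive_op (Y - X)"

definition inverse_ops :: "('h::chilbert_space \<Rightarrow>\<^sub>L 'h) \<Rightarrow> ('h \<Rightarrow>\<^sub>L 'h) \<Rightarrow> bool"
  where "inverse_ops T S \<longleftrightarrow> S \<in> bounded_ops \<and> T o\<^sub>L S = id_blinfun \<and> S o\<^sub>L T = id_blinfun"

definition invertible_op :: "('h::chilbert_space \<Rightarrow>\<^sub>L 'h) \<Rightarrow> bool"
  where "invertible_op T \<longleftrightarrow> (\<exists>S. inverse_ops T S)"

definition op_inv :: "('h::chilbert_space \<Rightarrow>\<^sub>L 'h) \<Rightarrow> ('h \<Rightarrow>\<^sub>L 'h)"
  where "op_inv T = (THE S. inverse_ops T S)"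

definition strictly_positive :: "('h::chilbert_space \<Rightarrow>\<^sub>L 'h) \<Rightarrow> bool"
  where "strictly_positive T \<longleftrightarrow> positive_op T \<and> invertible_op T"

(* \<open>T - z I\<close> is not invertible, written pointwise since blinfun has no complex scaling. *)
definition op_spectrum :: "('h::chilbert_space \<Rightarrow>\<^sub>L 'h) \<Rightarrow> complex set"
  where "op_spectrum T =
    {z. \<not> invertible_op (Blinfun (\<lambda>x. blinfun_apply T x - z *\<^sub>C x))}"

definition poly_op :: "real poly \<Rightarrow> ('h::chilbert_space \<Rightarrow>\<^sub>L 'h) \<Rightarrow> ('h \<Rightarrow>\<^sub>L 'h)"
  where "poly_op P T = (\<Sum>i\<le>degree P. coeff P i *\<^sub>R (((o\<^sub>L) T ^^ i) id_blinfun))"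

(* Continuous functional calculus f(T), for T self-adjoint (so that its spectrum is real) and f
   continuous on the spectrum of T: the norm limit of \<open>P\<^sub>n(T)\<close> for any real polynomials \<open>P\<^sub>n\<close>
   converging to f uniformly on the spectrum. *)
definition fun_calc :: "(real \<Rightarrow> real) \<Rightarrow> ('h::chilbert_space \<Rightarrow>\<^sub>L 'h) \<Rightarrow> ('h \<Rightarrow>\<^sub>L 'h)"
  where "fun_calc f T = (THE S. \<forall>P :: nat \<Rightarrow> real poly.
    uniform_limit {t. complex_of_real t \<in> op_spectrum T} (\<lambda>n t. poly (P n) t) f sequentially
      \<longrightarrow> (\<lambda>n. poly_op (P n) T) \<longlonglongrightarrow> S)"

definition op_powr :: "('h::chilbert_space \<Rightarrow>\<^sub>L 'h) \<Rightarrow> real \<Rightarrow> ('h \<Rightarrow>\<^sub>L 'h)"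
  where "op_powr T r = fun_calc (\<lambda>t. t powr r) T"

definition op_log :: "('h::chilbert_space \<Rightarrow>\<^sub>L 'h) \<Rightarrow> ('h \<Rightarrow>\<^sub>L 'h)"
  where "op_log T = fun_calc ln T"

definition geom_mean :: "real \<Rightarrow> ('h::chilbert_space \<Rightarrow>\<^sub>L 'h) \<Rightarrow> ('h \<Rightarrow>\<^sub>L 'h) \<Rightarrow> ('h \<Rightarrow>\<^sub>L 'h)"
  where "geom_mean p A B =
    op_powr A (1/2) o\<^sub>L op_powr (op_powr A (-1/2) o\<^sub>L B o\<^sub>L op_powr A (-1/2)) p
      o\<^sub>L op_powr A (1/2)"

definition harm_mean :: "real \<Rightarrow> ('h::chilbert_space \<Rightarrow>\<^sub>L 'h) \<Rightarrow> ('h \<Rightarrow>\<^sub>L 'h) \<Rightarrow> ('h \<Rightarrow>\<^sub>L 'h)"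
  where "harm_mean p A B = op_inv ((1 - p) *\<^sub>R op_inv A + p *\<^sub>R op_inv B)"

(* \<open>A\<^bsup>1/2\<^esup> (log A\<^bsup>-1/2\<^esup> B A\<^bsup>-1/2\<^esup>)\<^sup>2 A\<^bsup>1/2\<^esup>\<close> *)
definition log_square_term :: "('h::chilbert_space \<Rightarrow>\<^sub>L 'h) \<Rightarrow> ('h \<Rightarrow>\<^sub>L 'h) \<Rightarrow> ('h \<Rightarrow>\<^sub>L 'h)"
  where "log_square_term A B =
    (let L = op_log (op_powr A (-1/2) o\<^sub>L B o\<^sub>L op_powr A (-1/2))
     in op_powr A (1/2) o\<^sub>L (L o\<^sub>L L) o\<^sub>L op_powr A (1/2))"

end

(* With C = A^(-1/2) B A^(-1/2), both sides of the inequality are A^(1/2) F(C) A^(1/2) for explicit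
   continuous functions F on [u,v], and the spectrum of C lies in [u,v]; so the claim reduces to an
   inequality between functions of t > 0. There the geometric part (t^p - 1)/p increases in p by
   convexity of exp, and the loss in the harmonic part is paid for by the logarithmic term because
   4 (t-1)^2 / (t+1)^2 <= (ln t)^2.
   The functional calculus rests on |P(T)| <= sup |P| over the real spectrum of T: a real
   polynomial Q with Q(T) not invertible has a root in the spectrum, since its irreducible
   quadratic factors (t-a)^2 + b^2 give coercive, hence invertible, operators. *)

theory Submission
  imports Defs "HOL-Computational_Algebra.Fundamental_Theorem_Algebra"
begin

section \<open>Self-adjoint operators\<close>

text \<open>\<open>fun_calc\<close> is a definite description over all polynomial sequences that
  converge on the spectrum alone. It carries information only once such sequences are known to exist
  and all their operator values are known to share one norm limit; the norm bound on P(T) is there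
  to supply this. Since \<open>blinfun\<close> is real-linear, estimates are made with the real
  inner product, and complex linearity is carried along separately as membership in
  \<open>bounded_ops\<close>. Invertibility is always obtained from a quadratic form bounded below,
  so quadratic forms are the common currency of the spectral arguments.\<close>

lemma blinfun_compose_assoc: "(R o\<^sub>L S) o\<^sub>L T = R o\<^sub>L (S o\<^sub>L T)"
  by (rule blinfun_eqI) simp

lemmas blinfun_compose_distribs =
  bounded_bilinear.add_left[OF bounded_bilinear_blinfun_compose]
  bounded_bilinear.add_right[OF bounded_bilinear_blinfun_compose]
  bounded_bilinear.diff_left[OF bounded_bilinear_blinfun_compose]
  bounded_bilinear.diff_right[OF bounded_bilinear_blinfun_compose]
  bounded_bilinear.scaleR_left[OF bounded_bilinear_blinfun_compose]
  bounded_bilinear.scaleR_right[OF bounded_bilinear_blinfun_compose]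

lemma blinfun_compose_id [simp]: "T o\<^sub>L id_blinfun = T" "id_blinfun o\<^sub>L T = T"
  by (auto intro: blinfun_eqI)

lemma bounded_opsD: "T \<in> bounded_ops \<Longrightarrow> blinfun_apply T (c *\<^sub>C x) = c *\<^sub>C blinfun_apply T x"
  by (simp add: bounded_ops_def)

lemma scaleC_scaleR: "c *\<^sub>C (r *\<^sub>R x) = r *\<^sub>R (c *\<^sub>C x)" for x :: "'h::chilbert_space"
  by (metis mult.commute scaleC_of_real scaleC_scaleC)

lemma scaleC_zero_right: "c *\<^sub>C (0::'h::chilbert_space) = 0"
  by (metis add_cancel_right_left scaleC_add_right)

lemma scaleC_diff_right: "c *\<^sub>C (x - y) = c *\<^sub>C x - c *\<^sub>C y" for x :: "'h::chilbert_space"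
  by (metis add_diff_cancel diff_add_cancel scaleC_add_right)

lemma cinner_scaleC_left: "cinner (c *\<^sub>C x) y = cnj c * cinner x y" for x :: "'h::chilbert_space"
  by (metis cinner_commute cinner_scaleC_right complex_cnj_mult)

text \<open>The class ties the norm only to the real part of \<open>cinner\<close>, but conjugate
  symmetry makes \<open>cinner x x\<close> real. This gives continuity of complex scaling, so that
  complex linearity passes to limits of operators.\<close>

lemma norm_scaleC: "norm (c *\<^sub>C x) = cmod c * norm x" for x :: "'h::chilbert_space"
proof -
  have "Im (cinner x x) = 0"
    using arg_cong[OF cinner_commute[of x x], of Im] by simp
  have "inner (c *\<^sub>C x) (c *\<^sub>C x) = Re (c * cnj c * cinner x x)"
    by (simp add: inner_eq_Re_cinner cinner_scaleC_left cinner_scaleC_right mult_ac)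
  also have "\<dots> = (cmod c)\<^sup>2 * inner x x"
    using \<open>Im (cinner x x) = 0\<close>
    by (simp add: complex_mult_cnj cmod_power2 inner_eq_Re_cinner del: of_real_power)
  finally have "(norm (c *\<^sub>C x))\<^sup>2 = (cmod c * norm x)\<^sup>2"
    by (simp add: power2_norm_eq_inner power_mult_distrib)
  then show ?thesis
    by (simp add: power2_eq_iff_nonneg)
qed

lemma bounded_linear_scaleC: "bounded_linear (\<lambda>x. c *\<^sub>C (x::'h::chilbert_space))"
  by (rule bounded_linear_intro[where K = "cmod c"])
    (simp_all add: scaleC_add_right scaleC_scaleR norm_scaleC)

lemma bounded_ops_id [simp]: "id_blinfun \<in> bounded_ops"
  by (simp add: bounded_ops_def)

lemma bounded_ops_compose: "S \<in> bounded_ops \<Longrightarrow> T \<in> bounded_ops \<Longrightarrow> S o\<^sub>L T \<in> bounded_ops"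
  by (simp add: bounded_ops_def)

lemma bounded_ops_zero [simp]: "0 \<in> bounded_ops"
  by (simp add: bounded_ops_def scaleC_zero_right)

lemma bounded_ops_add: "S \<in> bounded_ops \<Longrightarrow> T \<in> bounded_ops \<Longrightarrow> S + T \<in> bounded_ops"
  by (simp add: bounded_ops_def blinfun.add_left scaleC_add_right)

lemma bounded_ops_scaleR: "T \<in> bounded_ops \<Longrightarrow> r *\<^sub>R T \<in> bounded_ops"
  by (simp add: bounded_ops_def blinfun.scaleR_left scaleC_scaleR)

lemma bounded_ops_diff: "S \<in> bounded_ops \<Longrightarrow> T \<in> bounded_ops \<Longrightarrow> S - T \<in> bounded_ops"
  by (simp add: bounded_ops_def blinfun.diff_left scaleC_diff_right)

lemma bounded_ops_limit:
  assumes "\<And>n. F n \<in> bounded_ops" and "F \<longlonglongrightarrow> T"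
  shows "T \<in> bounded_ops"
proof -
  have lim: "(\<lambda>n. blinfun_apply (F n) x) \<longlonglongrightarrow> blinfun_apply T x" for x
    by (intro tendsto_intros assms)
  have "blinfun_apply T (c *\<^sub>C x) = c *\<^sub>C blinfun_apply T x" for c x
  proof (rule LIMSEQ_unique[OF lim])
    show "(\<lambda>n. blinfun_apply (F n) (c *\<^sub>C x)) \<longlonglongrightarrow> c *\<^sub>C blinfun_apply T x"
      using bounded_linear.tendsto[OF bounded_linear_scaleC lim]
      by (simp add: bounded_opsD[OF assms(1)])
  qed
  then show ?thesis by (simp add: bounded_ops_def)
qed

lemma Im_cinner: "Im (cinner x y) = inner (\<i> *\<^sub>C x) y" for x :: "'h::chilbert_space"
  by (simp add: inner_eq_Re_cinner cinner_scaleC_left)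

text \<open>The imaginary part of \<open>cinner\<close> is the real inner product after rotation by
  \<i>. A real-symmetric operator that commutes with this rotation is therefore symmetric for
  \<open>cinner\<close> as well.\<close>

lemma self_adjoint_iff:
  "self_adjoint T \<longleftrightarrow>
    T \<in> bounded_ops \<and> (\<forall>x y. inner (blinfun_apply T x) y = inner x (blinfun_apply T y))"
proof safe
  assume T: "T \<in> bounded_ops"
    and sym: "\<forall>x y. inner (blinfun_apply T x) y = inner x (blinfun_apply T y)"
  have "cinner (blinfun_apply T x) y = cinner x (blinfun_apply T y)" for x y
    by (rule complex_eqI)
      (simp_all add: sym flip: inner_eq_Re_cinner, simp add: Im_cinner sym flip: bounded_opsD[OF T])
  with T show "self_adjoint T" by (simp add: self_adjoint_def)
qed (auto simp: self_adjoint_def inner_eq_Re_cinner)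

lemma self_adjoint_bounded_ops: "self_adjoint T \<Longrightarrow> T \<in> bounded_ops"
  by (simp add: self_adjoint_def)

lemma self_adjoint_inner:
  "self_adjoint T \<Longrightarrow> inner (blinfun_apply T x) y = inner x (blinfun_apply T y)"
  by (simp add: self_adjoint_iff)

lemma self_adjoint_id [simp]: "self_adjoint id_blinfun"
  by (simp add: self_adjoint_iff)

lemma self_adjoint_zero [simp]: "self_adjoint 0"
  by (simp add: self_adjoint_iff)

lemma self_adjoint_add: "self_adjoint S \<Longrightarrow> self_adjoint T \<Longrightarrow> self_adjoint (S + T)"
  by (simp add: self_adjoint_iff bounded_ops_add blinfun.add_left inner_add_left inner_add_right)

lemma self_adjoint_scaleR: "self_adjoint T \<Longrightarrow> self_adjoint (r *\<^sub>R T)"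
  by (simp add: self_adjoint_iff bounded_ops_scaleR blinfun.scaleR_left)

lemma self_adjoint_diff: "self_adjoint S \<Longrightarrow> self_adjoint T \<Longrightarrow> self_adjoint (S - T)"
  by (simp add: self_adjoint_iff bounded_ops_diff blinfun.diff_left inner_diff_left inner_diff_right)

lemma self_adjoint_compose:
  assumes "self_adjoint S" "self_adjoint T" "S o\<^sub>L T = T o\<^sub>L S"
  shows "self_adjoint (S o\<^sub>L T)"
  unfolding self_adjoint_iff
proof safe
  show "S o\<^sub>L T \<in> bounded_ops"
    using assms by (simp add: bounded_ops_compose self_adjoint_bounded_ops)
  fix x y
  have "inner (blinfun_apply (S o\<^sub>L T) x) y = inner x (blinfun_apply (T o\<^sub>L S) y)"
    using assms(1,2) by (simp add: self_adjoint_inner)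
  then show "inner (blinfun_apply (S o\<^sub>L T) x) y = inner x (blinfun_apply (S o\<^sub>L T) y)"
    by (simp only: assms(3))
qed

lemma self_adjoint_sandwich:
  assumes "self_adjoint R" "self_adjoint T"
  shows "self_adjoint (R o\<^sub>L T o\<^sub>L R)"
  using assms by (simp add: self_adjoint_iff bounded_ops_compose)

lemma self_adjoint_limit:
  assumes "\<And>n. self_adjoint (F n)" and "F \<longlonglongrightarrow> T"
  shows "self_adjoint T"
  unfolding self_adjoint_iff
proof safe
  show "T \<in> bounded_ops"
    using assms bounded_ops_limit self_adjoint_bounded_ops by blast
  fix x y
  have "(\<lambda>n. inner (blinfun_apply (F n) x) y) \<longlonglongrightarrow> inner (blinfun_apply T x) y"
    by (intro tendsto_intros assms)
  moreover have "(\<lambda>n. inner x (blinfun_apply (F n) y)) \<longlonglongrightarrow> inner x (blinfun_apply T y)"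
    by (intro tendsto_intros assms)
  ultimately show "inner (blinfun_apply T x) y = inner x (blinfun_apply T y)"
    using LIMSEQ_unique by (simp add: self_adjoint_inner[OF assms(1)])
qed

lemma positive_op_iff:
  "positive_op T \<longleftrightarrow> self_adjoint T \<and> (\<forall>x. 0 \<le> inner x (blinfun_apply T x))"
  by (simp add: positive_op_def inner_eq_Re_cinner)

section \<open>Invertible operators\<close>

lemma inverse_ops_unique: "inverse_ops T S \<Longrightarrow> inverse_ops T S' \<Longrightarrow> S = S'"
  unfolding inverse_ops_def
  by (metis blinfun_compose_assoc blinfun_compose_id)

lemma op_inv_eqI: "inverse_ops T S \<Longrightarrow> op_inv T = S"
  unfolding op_inv_def using inverse_ops_unique by blast

lemma invertible_op_id: "invertible_op id_blinfun"
  unfolding invertible_op_def inverse_ops_def by (rule exI[of _ id_blinfun]) simp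

lemma invertible_op_compose:
  assumes "invertible_op S" "invertible_op T"
  shows "invertible_op (S o\<^sub>L T)"
proof -
  obtain S' T' where "inverse_ops S S'" "inverse_ops T T'"
    using assms unfolding invertible_op_def by blast
  then have "inverse_ops (S o\<^sub>L T) (T' o\<^sub>L S')"
    unfolding inverse_ops_def
    by (metis bounded_ops_compose blinfun_compose_assoc blinfun_compose_id)
  then show ?thesis unfolding invertible_op_def by blast
qed

lemma invertible_op_scaleR:
  assumes "invertible_op T" "r \<noteq> 0"
  shows "invertible_op (r *\<^sub>R T)"
proof -
  obtain T' where "inverse_ops T T'"
    using assms unfolding invertible_op_def by blast
  then have "inverse_ops (r *\<^sub>R T) ((1/r) *\<^sub>R T')"
    using assms(2) unfolding inverse_ops_def
    by (simp add: bounded_ops_scaleR blinfun_compose_distribs)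
  then show ?thesis unfolding invertible_op_def by blast
qed

text \<open>Lax--Milgram: for small \<open>c\<close> the map \<open>x \<mapsto> x - c (T x - y)\<close> is a contraction, whose
  fixed point solves \<open>T x = y\<close>.\<close>

lemma coercive_invertible:
  fixes T :: "'h::chilbert_space \<Rightarrow>\<^sub>L 'h"
  assumes T: "T \<in> bounded_ops" and "0 < e"
    and coercive: "\<And>x. e * (norm x)\<^sup>2 \<le> inner x (blinfun_apply T x)"
  shows "invertible_op T"
proof -
  have below: "e * norm x \<le> norm (blinfun_apply T x)" for x
  proof (cases "x = 0")
    case False
    have "e * norm x * norm x \<le> norm (blinfun_apply T x) * norm x"
      using coercive[of x] norm_cauchy_schwarz[of x "blinfun_apply T x"]
      by (simp add: power2_eq_square mult_ac)
    then show ?thesis using False by simp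
  qed simp
  \<comment> \<open>Adding \<open>e\<close> gives \<open>M > 0\<close> and \<open>e \<le> M\<close>
    together; the latter keeps the radicand of \<open>k\<close> nonnegative.\<close>
  define M where "M = norm T + e"
  have "M > 0" "e \<le> M"
    using \<open>0 < e\<close> norm_ge_zero[of T] unfolding M_def by linarith+
  have M: "norm (blinfun_apply T x) \<le> M * norm x" for x
    using \<open>0 < e\<close> norm_blinfun[of T x] by (simp add: M_def distrib_right add_increasing2)
  \<comment> \<open>This \<open>c\<close> minimises the squared contraction factor 1 - 2ce + (cM)^2;
    the minimum is 1 - ce, the square of \<open>k\<close>.\<close>
  define c where "c = e / M\<^sup>2"
  define k where "k = sqrt (1 - c * e)"
  have "c > 0" using \<open>0 < e\<close> \<open>M > 0\<close> by (simp add: c_def)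
  have "c * e \<le> 1"
    using \<open>0 < e\<close> \<open>e \<le> M\<close> \<open>M > 0\<close> by (simp add: c_def field_simps power2_eq_square mult_mono)
  have k: "0 \<le> k" "k < 1"
    using \<open>c * e \<le> 1\<close> \<open>c > 0\<close> \<open>0 < e\<close> by (simp_all add: k_def)
  have contraction: "norm (x - c *\<^sub>R blinfun_apply T x) \<le> k * norm x" for x
  proof (rule power2_le_imp_le)
    have "(norm (x - c *\<^sub>R blinfun_apply T x))\<^sup>2
        = (norm x)\<^sup>2 - 2 * c * inner x (blinfun_apply T x) + c\<^sup>2 * (norm (blinfun_apply T x))\<^sup>2"
      unfolding power2_norm_eq_inner
      by (simp add: inner_diff_left inner_diff_right inner_commute algebra_simps power2_eq_square)
    also have "\<dots> \<le> (norm x)\<^sup>2 - 2 * c * (e * (norm x)\<^sup>2) + c\<^sup>2 * (M * norm x)\<^sup>2"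
      using \<open>c > 0\<close> coercive[of x] M[of x] by (intro add_mono diff_mono mult_left_mono power_mono) auto
    also have "\<dots> = (1 - c * e) * (norm x)\<^sup>2"
      using \<open>M > 0\<close> by (simp add: c_def field_simps power2_eq_square)
    also have "\<dots> = (k * norm x)\<^sup>2"
      using \<open>c * e \<le> 1\<close> by (simp add: k_def power_mult_distrib)
    finally show "(norm (x - c *\<^sub>R blinfun_apply T x))\<^sup>2 \<le> (k * norm x)\<^sup>2" .
  qed (simp add: k)
  have surj: "\<exists>x. blinfun_apply T x = y" for y
  proof -
    have "\<exists>!x. x - c *\<^sub>R (blinfun_apply T x - y) = x"
    proof (rule banach_fix_type[OF k], intro allI)
      fix x x'
      show "dist (x - c *\<^sub>R (blinfun_apply T x - y)) (x' - c *\<^sub>R (blinfun_apply T x' - y))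
          \<le> k * dist x x'"
        using contraction[of "x - x'"] by (simp add: dist_norm algebra_simps blinfun.diff_right)
    qed
    then obtain x where "x - c *\<^sub>R (blinfun_apply T x - y) = x" by blast
    then have "blinfun_apply T x - y = 0" using \<open>c > 0\<close> by simp
    then show ?thesis by auto
  qed
  define g where "g y = (SOME x. blinfun_apply T x = y)" for y
  have Tg: "blinfun_apply T (g y) = y" for y
    unfolding g_def using someI_ex[OF surj] .
  \<comment> \<open>Injectivity follows from the lower bound on the norm of T x, and lets every law
    of \<open>g\<close> be checked after applying \<open>T\<close>.\<close>
  have inj: "x = x'" if "blinfun_apply T x = blinfun_apply T x'" for x x'
    using below[of "x - x'"] that \<open>0 < e\<close> by (simp add: blinfun.diff_right mult_le_0_iff)
  have "bounded_linear g"
  proof (rule bounded_linear_intro[where K = "1/e"])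
    fix x y and r :: real
    show "g (x + y) = g x + g y" by (rule inj) (simp add: Tg blinfun.add_right)
    show "g (r *\<^sub>R x) = r *\<^sub>R g x" by (rule inj) (simp add: Tg blinfun.scaleR_right)
    show "norm (g x) \<le> norm x * (1 / e)"
      using below[of "g x"] \<open>0 < e\<close> by (simp add: Tg field_simps)
  qed
  then have g: "blinfun_apply (Blinfun g) = g" by (rule bounded_linear_Blinfun_apply)
  have "g (c *\<^sub>C x) = c *\<^sub>C g x" for c x
    by (rule inj) (simp add: Tg bounded_opsD[OF T])
  moreover have "g (blinfun_apply T x) = x" for x
    by (rule inj) (simp add: Tg)
  ultimately have "inverse_ops T (Blinfun g)"
    unfolding inverse_ops_def bounded_ops_def by (auto intro: blinfun_eqI simp: g Tg)
  then show ?thesis unfolding invertible_op_def by blast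
qed

text \<open>Expanding \<open>0 \<le> \<langle>y, T y\<rangle>\<close> at \<open>y = x - T x / M\<close> gives \<open>\<parallel>T x\<parallel>\<^sup>2 \<le> M \<langle>x, T x\<rangle>\<close>.\<close>

lemma positive_invertible_coercive:
  fixes T :: "'h::chilbert_space \<Rightarrow>\<^sub>L 'h"
  assumes "positive_op T" "invertible_op T"
  obtains e where "0 < e" "\<And>x. e * (norm x)\<^sup>2 \<le> inner x (blinfun_apply T x)"
proof -
  have sa: "self_adjoint T" and pos: "\<And>x. 0 \<le> inner x (blinfun_apply T x)"
    using assms(1) by (auto simp: positive_op_iff)
  obtain S where S: "S o\<^sub>L T = id_blinfun"
    using assms(2) unfolding invertible_op_def inverse_ops_def by blast
  define M where "M = norm T + 1"
  define N where "N = norm S + 1"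
  have MN: "M > 0" "N > 0" by (simp_all add: M_def N_def add_nonneg_pos)
  have *: "(norm (blinfun_apply T x))\<^sup>2 \<le> M * inner x (blinfun_apply T x)" for x
  proof -
    let ?y = "blinfun_apply T x"
    have "inner ?y (blinfun_apply T ?y) \<le> norm ?y * (norm T * norm ?y)"
      by (rule order_trans[OF norm_cauchy_schwarz mult_left_mono]) (simp_all add: norm_blinfun)
    also have "\<dots> \<le> M * (norm ?y)\<^sup>2"
      by (simp add: M_def power2_eq_square algebra_simps)
    finally have 1: "inner ?y (blinfun_apply T ?y) \<le> M * (norm ?y)\<^sup>2" .
    have expand: "inner (x - r *\<^sub>R ?y) (blinfun_apply T (x - r *\<^sub>R ?y))
        = inner x ?y - 2 * r * (norm ?y)\<^sup>2 + r\<^sup>2 * inner ?y (blinfun_apply T ?y)" for r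
      using self_adjoint_inner[OF sa, of x "?y"] unfolding power2_norm_eq_inner
      by (simp add: blinfun.diff_right blinfun.scaleR_right inner_diff_left inner_diff_right
          power2_eq_square algebra_simps)
    have "0 \<le> inner (x - (1/M) *\<^sub>R ?y) (blinfun_apply T (x - (1/M) *\<^sub>R ?y))" by (rule pos)
    also have "\<dots> = inner x ?y - 2 / M * (norm ?y)\<^sup>2
        + (1/M)\<^sup>2 * inner ?y (blinfun_apply T ?y)"
      unfolding expand by simp
    also have "\<dots> \<le> inner x ?y - 2 / M * (norm ?y)\<^sup>2 + (1/M)\<^sup>2 * (M * (norm ?y)\<^sup>2)"
      using 1 by (intro add_left_mono mult_left_mono) auto
    also have "\<dots> = inner x ?y - (norm ?y)\<^sup>2 / M"
      using MN by (simp add: field_simps power2_eq_square)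
    finally show ?thesis using MN by (simp add: field_simps)
  qed
  have "1 / (M * N\<^sup>2) * (norm x)\<^sup>2 \<le> inner x (blinfun_apply T x)" for x
  proof -
    have "norm x = norm (blinfun_apply (S o\<^sub>L T) x)" by (simp add: S)
    also have "\<dots> \<le> norm S * norm (blinfun_apply T x)" by (simp add: norm_blinfun)
    also have "\<dots> \<le> N * norm (blinfun_apply T x)" by (simp add: N_def mult_right_mono)
    finally have "(norm x)\<^sup>2 \<le> N\<^sup>2 * (norm (blinfun_apply T x))\<^sup>2"
      by (metis norm_ge_zero power_mono power_mult_distrib)
    also have "\<dots> \<le> N\<^sup>2 * (M * inner x (blinfun_apply T x))"
      by (intro mult_left_mono *) auto
    finally show ?thesis using MN by (simp add: field_simps)
  qed
  then show thesis using MN by (intro that[of "1 / (M * N\<^sup>2)"]) auto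
qed

section \<open>Polynomials of an operator\<close>

lemma poly_op_0 [simp]: "poly_op 0 T = 0"
  by (simp add: poly_op_def)

text \<open>Horner's recursion; with it the algebraic laws of \<open>poly_op\<close> follow by
  induction on the polynomial instead of by manipulating sums.\<close>

lemma poly_op_pCons: "poly_op (pCons a P) T = a *\<^sub>R id_blinfun + (T o\<^sub>L poly_op P T)"
proof (cases "P = 0")
  case False
  then have "poly_op (pCons a P) T = a *\<^sub>R id_blinfun
      + (\<Sum>i\<le>degree P. coeff P i *\<^sub>R (T o\<^sub>L (((o\<^sub>L) T ^^ i) id_blinfun)))"
    by (simp add: poly_op_def degree_pCons_eq sum.atMost_Suc_shift del: sum.atMost_Suc)
  then show ?thesis
    by (simp add: poly_op_def blinfun_compose_distribs
        bounded_bilinear.sum_right[OF bounded_bilinear_blinfun_compose])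
next
  case True
  then show ?thesis
    by (simp add: poly_op_def bounded_bilinear.zero_right[OF bounded_bilinear_blinfun_compose])
qed

lemma poly_op_const: "poly_op [:a:] T = a *\<^sub>R id_blinfun"
  by (simp add: poly_op_pCons bounded_bilinear.zero_right[OF bounded_bilinear_blinfun_compose])

lemma poly_op_X: "poly_op [:0, 1:] T = T"
  by (simp add: poly_op_pCons bounded_bilinear.zero_right[OF bounded_bilinear_blinfun_compose])

lemma poly_op_add: "poly_op (P + Q) T = poly_op P T + poly_op Q T"
  by (induction P Q rule: poly_induct2)
    (simp_all add: poly_op_pCons blinfun_compose_distribs scaleR_left_distrib)

lemma poly_op_smult: "poly_op (smult c P) T = c *\<^sub>R poly_op P T"
  by (induction P) (simp_all add: poly_op_pCons blinfun_compose_distribs scaleR_right_distrib)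

lemma poly_op_diff: "poly_op (P - Q) T = poly_op P T - poly_op Q T"
  using poly_op_add[of P "smult (-1) Q" T] unfolding poly_op_smult by simp

lemma poly_op_mult: "poly_op (P * Q) T = poly_op P T o\<^sub>L poly_op Q T"
proof (induction P)
  case 0
  then show ?case by (simp add: bounded_bilinear.zero_left[OF bounded_bilinear_blinfun_compose])
next
  case (pCons a P)
  then show ?case
    by (simp add: poly_op_add poly_op_smult poly_op_pCons blinfun_compose_distribs
        blinfun_compose_assoc)
qed

lemma poly_op_commute: "poly_op P T o\<^sub>L poly_op Q T = poly_op Q T o\<^sub>L poly_op P T"
  by (metis mult.commute poly_op_mult)

lemma self_adjoint_poly_op:
  assumes "self_adjoint T"
  shows "self_adjoint (poly_op P T)"
proof (induction P)
  case (pCons a P)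
  have "T o\<^sub>L poly_op P T = poly_op P T o\<^sub>L T"
    using poly_op_commute[of "[:0, 1:]" T P] by (simp add: poly_op_X)
  with pCons assms show ?case
    by (simp add: poly_op_pCons self_adjoint_add self_adjoint_scaleR self_adjoint_compose)
qed simp

section \<open>Real spectrum, and bounds on P(T) by the values of P there\<close>

text \<open>The set on which \<open>fun_calc\<close> asks for uniform convergence.\<close>

definition real_spectrum :: "('h::chilbert_space \<Rightarrow>\<^sub>L 'h) \<Rightarrow> real set"
  where "real_spectrum T = {t. complex_of_real t \<in> op_spectrum T}"

lemma mem_real_spectrum_iff: "t \<in> real_spectrum T \<longleftrightarrow> \<not> invertible_op (T - t *\<^sub>R id_blinfun)"
proof -
  have "(\<lambda>x. blinfun_apply T x - complex_of_real t *\<^sub>C x) = blinfun_apply (T - t *\<^sub>R id_blinfun)"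
    by (simp add: fun_eq_iff blinfun.diff_left blinfun.scaleR_left scaleC_of_real)
  then show ?thesis
    by (simp add: real_spectrum_def op_spectrum_def blinfun_apply_inverse)
qed

text \<open>Over the complex numbers P has a root z = a + ib, not real by assumption. Division by
  the real quadratic with roots a + ib and a - ib leaves a real remainder r0 + r1 z = 0 at z; its
  imaginary part b r1 = 0 forces r1 = 0, hence r0 = 0.\<close>

lemma real_poly_quadratic_factor:
  fixes P :: "real poly"
  assumes "degree P > 0" and "\<And>t. poly P t \<noteq> 0"
  obtains a b where "b \<noteq> 0" "[:a\<^sup>2 + b\<^sup>2, - 2 * a, 1:] dvd P"
proof -
  let ?cpx = "map_poly complex_of_real"
  have cpx: "poly (?cpx (pCons c Q)) z = of_real c + z * poly (?cpx Q) z" for c Q z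
    by (simp add: map_poly_pCons)
  have cpx_add: "poly (?cpx (P + Q)) z = poly (?cpx P) z + poly (?cpx Q) z" for P Q z
    by (induction P Q rule: poly_induct2) (simp_all add: cpx algebra_simps)
  have cpx_smult: "poly (?cpx (smult c Q)) z = of_real c * poly (?cpx Q) z" for c Q z
    by (induction Q) (simp_all add: cpx algebra_simps)
  have cpx_mult: "poly (?cpx (P * Q)) z = poly (?cpx P) z * poly (?cpx Q) z" for P Q z
    by (induction P) (simp_all add: cpx cpx_add cpx_smult algebra_simps)
  have cpx_real: "poly (?cpx Q) (of_real t) = of_real (poly Q t)" for Q t
    by (induction Q) (simp_all add: cpx)
  have "\<not> constant (poly (?cpx P))"
    using assms(1) by (simp add: constant_degree degree_map_poly)
  then obtain z where z: "poly (?cpx P) z = 0"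
    using fundamental_theorem_of_algebra by blast
  define a b where "a = Re z" and "b = Im z"
  have "b \<noteq> 0"
  proof
    assume "b = 0"
    then have "z = of_real a" by (simp add: a_def b_def complex_eq_iff)
    with z assms(2) show False by (simp add: cpx_real)
  qed
  define D where "D = [:a\<^sup>2 + b\<^sup>2, - 2 * a, 1:]"
  have "degree D = 2" "D \<noteq> 0" by (simp_all add: D_def)
  then have "degree (P mod D) \<le> 1"
    using degree_mod_less[of D P] by fastforce
  then have R: "P mod D = [:coeff (P mod D) 0, coeff (P mod D) 1:]"
    by (intro poly_eqI) (auto simp: coeff_pCons coeff_eq_0 split: nat.splits)
  have "poly (?cpx D) z = 0"
    by (simp add: D_def cpx a_def b_def complex_eq_iff algebra_simps power2_eq_square)
  then have "poly (?cpx (P mod D)) z = 0"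
    using z cpx_add[of "P div D * D" "P mod D" z] by (simp add: cpx_mult)
  then have "of_real (coeff (P mod D) 0) + z * of_real (coeff (P mod D) 1) = 0"
    by (subst (asm) R) (simp add: cpx)
  then have "coeff (P mod D) 0 + a * coeff (P mod D) 1 = 0" "b * coeff (P mod D) 1 = 0"
    by (simp_all add: complex_eq_iff a_def b_def)
  then have "P mod D = 0"
    using \<open>b \<noteq> 0\<close> R by simp
  then show thesis
    using \<open>b \<noteq> 0\<close> that unfolding D_def by blast
qed

text \<open>One inclusion of the spectral mapping theorem, stated at the value 0; other values m are
  reached through P - m. The induction strips off factors D with D(T) invertible until a linear
  factor with spectral root appears.\<close>

lemma poly_op_not_invertible_root:
  assumes "self_adjoint T" "P \<noteq> 0" "\<not> invertible_op (poly_op P T)"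
  shows "\<exists>t\<in>real_spectrum T. poly P t = 0"
  using assms(2,3)
proof (induction "degree P" arbitrary: P rule: less_induct)
  case less
  \<comment> \<open>If D(T) is invertible, then Q(T) cannot be, and Q has smaller degree; a root of
    Q is a root of P.\<close>
  have step: ?case if "P = D * Q" "degree D > 0" "invertible_op (poly_op D T)" for D Q
  proof -
    have "Q \<noteq> 0" "D \<noteq> 0" using less.prems that by auto
    then have "degree Q < degree P" using that by (simp add: degree_mult_eq)
    moreover have "\<not> invertible_op (poly_op Q T)"
      using less.prems(2) that invertible_op_compose by (auto simp: poly_op_mult)
    ultimately show ?thesis using less.hyps \<open>Q \<noteq> 0\<close> that by fastforce
  qed
  consider "degree P = 0" | t where "poly P t = 0" | "degree P > 0" "\<And>t. poly P t \<noteq> 0"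
    by blast
  then show ?case
  proof cases
    case 1
    then obtain c where "P = [:c:]" by (rule degree_eq_zeroE)
    with less.prems show ?thesis
      by (auto simp: poly_op_const invertible_op_id invertible_op_scaleR)
  next
    case 2
    then obtain Q where Q: "P = [:- t, 1:] * Q" by (auto simp: poly_eq_0_iff_dvd)
    have "poly_op [:- t, 1:] T = T - t *\<^sub>R id_blinfun"
      by (simp add: poly_op_pCons bounded_bilinear.zero_right[OF bounded_bilinear_blinfun_compose])
    \<comment> \<open>Either t is itself the root sought, or its linear factor is invertible and can
      be stripped off.\<close>
    then have "t \<notin> real_spectrum T \<Longrightarrow> invertible_op (poly_op [:- t, 1:] T)"
      by (simp add: mem_real_spectrum_iff)
    moreover have "degree [:- t, 1:] > 0" by simp
    ultimately show ?thesis
      using 2 step[OF Q] by blast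
  next
    case 3
    then obtain a b Q where b: "b \<noteq> 0" and Q: "P = [:a\<^sup>2 + b\<^sup>2, - 2 * a, 1:] * Q"
      by (metis real_poly_quadratic_factor dvdE)
    let ?D = "[:a\<^sup>2 + b\<^sup>2, - 2 * a, 1:]"
    define S where "S = poly_op [:- a, 1:] T"
    have S: "self_adjoint S" unfolding S_def by (rule self_adjoint_poly_op[OF assms(1)])
    \<comment> \<open>Completing the square turns the quadratic form of the factor into |S x|^2 +
      b^2 |x|^2, which is coercive because b is nonzero.\<close>
    have "?D = [:- a, 1:] * [:- a, 1:] + [:b\<^sup>2:]" by (simp add: power2_eq_square)
    then have D: "poly_op ?D T = (S o\<^sub>L S) + b\<^sup>2 *\<^sub>R id_blinfun"
      unfolding S_def by (simp only: poly_op_add poly_op_mult poly_op_const)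
    have "invertible_op (poly_op ?D T)"
    proof (rule coercive_invertible)
      show "poly_op ?D T \<in> bounded_ops"
        using assms(1) self_adjoint_poly_op self_adjoint_bounded_ops by blast
      show "b\<^sup>2 * (norm x)\<^sup>2 \<le> inner x (blinfun_apply (poly_op ?D T) x)" for x
        unfolding D
        by (simp add: blinfun.add_left blinfun.scaleR_left inner_add_right power2_norm_eq_inner
            self_adjoint_inner[OF S, of x, symmetric])
    qed (use b in simp)
    moreover have "degree ?D > 0" by simp
    ultimately show ?thesis using step[OF Q] by blast
  qed
qed

text \<open>The infimum \<open>m\<close> of the quadratic form of \<open>P(T)\<close> on unit vectors is a spectral value of
  \<open>P(T)\<close>, hence a value of \<open>P\<close> on the spectrum of \<open>T\<close>.\<close>

lemma positive_op_poly_op: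
  fixes T :: "'h::chilbert_space \<Rightarrow>\<^sub>L 'h"
  assumes sa: "self_adjoint T" and pos: "\<And>t. t \<in> real_spectrum T \<Longrightarrow> 0 \<le> poly P t"
  shows "positive_op (poly_op P T)"
proof (rule ccontr)
  \<comment> \<open>Stated for arbitrary \<open>Q\<close> because it is used twice: for
    \<open>P\<close>, and for the identity polynomial, where it shows that the spectrum is nonempty.
    The vector \<open>x0\<close> guarantees that there are unit vectors to take an infimum
    over.\<close>
  have numeric_min: "\<exists>m. \<not> invertible_op (poly_op (Q - [:m:]) T)
      \<and> m * (norm x0)\<^sup>2 \<le> inner x0 (blinfun_apply (poly_op Q T) x0)" if "x0 \<noteq> 0" for Q x0
  proof -
    define S where "S = poly_op Q T"
    have S: "self_adjoint S" unfolding S_def by (rule self_adjoint_poly_op[OF sa])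
    define V where "V = (\<lambda>x. inner x (blinfun_apply S x)) ` {x. norm x = 1}"
    have lower: "- norm S \<le> v" if "v \<in> V" for v
    proof -
      obtain x where x: "v = inner x (blinfun_apply S x)" "norm x = 1"
        using \<open>v \<in> V\<close> by (auto simp: V_def)
      have "\<bar>v\<bar> \<le> norm S"
        using Cauchy_Schwarz_ineq2[of x "blinfun_apply S x"] norm_blinfun[of S x] x by simp
      then show ?thesis by simp
    qed
    then have bdd: "bdd_below V" by (rule bdd_belowI)
    define m where "m = Inf V"
    have unit: "norm (x /\<^sub>R norm x) = 1" if "x \<noteq> 0" for x :: 'h
      using that by simp
    have m: "m * (norm x)\<^sup>2 \<le> inner x (blinfun_apply S x)" for x
    proof (cases "x = 0")
      case False
      have "m \<le> inner (x /\<^sub>R norm x) (blinfun_apply S (x /\<^sub>R norm x))"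
        unfolding m_def V_def using unit[OF False] by (intro cInf_lower bdd[unfolded V_def] imageI) simp
      then show ?thesis
        using False by (simp add: blinfun.scaleR_right field_simps power2_eq_square)
    qed simp
    have "V \<noteq> {}" using unit[OF that] unfolding V_def by blast
    have diff: "poly_op (Q - [:m:]) T = S - m *\<^sub>R id_blinfun"
      by (simp add: S_def poly_op_diff poly_op_const del: diff_pCons)
    have form: "inner x (blinfun_apply (S - m *\<^sub>R id_blinfun) x)
        = inner x (blinfun_apply S x) - m * (norm x)\<^sup>2" for x
      by (simp add: blinfun.diff_left blinfun.scaleR_left inner_diff_right power2_norm_eq_inner)
    have "positive_op (S - m *\<^sub>R id_blinfun)"
      unfolding positive_op_iff form
      using S m by (simp add: self_adjoint_diff self_adjoint_scaleR)
    \<comment> \<open>A coercivity constant \<open>e\<close> would make m + e a lower bound of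
      \<open>V\<close>, above its infimum. A positive operator that is not coercive is not
      invertible.\<close>
    moreover have "\<not> (\<forall>x. e * (norm x)\<^sup>2 \<le> inner x (blinfun_apply (S - m *\<^sub>R id_blinfun) x))"
      if "e > 0" for e
    proof
      assume *: "\<forall>x. e * (norm x)\<^sup>2 \<le> inner x (blinfun_apply (S - m *\<^sub>R id_blinfun) x)"
      have "m + e \<le> v" if v: "v \<in> V" for v
      proof -
        obtain x where "v = inner x (blinfun_apply S x)" "norm x = 1"
          using v by (auto simp: V_def)
        then show ?thesis using *[unfolded form, rule_format, of x] by simp
      qed
      then have "m + e \<le> m"
        unfolding m_def using \<open>V \<noteq> {}\<close> by (intro cInf_greatest) auto
      with \<open>e > 0\<close> show False by simp
    qed
    ultimately have "\<not> invertible_op (S - m *\<^sub>R id_blinfun)"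
      by (metis positive_invertible_coercive)
    then show ?thesis using m[of x0] unfolding diff[symmetric] by (auto simp: S_def)
  qed
  assume "\<not> positive_op (poly_op P T)"
  then obtain x where x: "inner x (blinfun_apply (poly_op P T) x) < 0"
    using self_adjoint_poly_op[OF sa] by (auto simp: positive_op_iff not_le)
  then have "x \<noteq> 0" by auto
  then obtain m where m: "\<not> invertible_op (poly_op (P - [:m:]) T)"
      "m * (norm x)\<^sup>2 \<le> inner x (blinfun_apply (poly_op P T) x)"
    using numeric_min by blast
  have "m * (norm x)\<^sup>2 < 0" using m(2) x by linarith
  then have "m < 0" by (simp add: mult_less_0_iff)
  have "\<exists>t\<in>real_spectrum T. poly P t = m"
  proof (cases "P = [:m:]")
    case False
    then show ?thesis
      using poly_op_not_invertible_root[OF sa _ m(1)] by auto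
  next
    \<comment> \<open>Here P - m is the zero polynomial and says nothing about roots; any point of
      the spectrum serves.\<close>
    case True
    obtain t where "\<not> invertible_op (poly_op ([:0, 1:] - [:t:]) T)"
      using numeric_min[OF \<open>x \<noteq> 0\<close>] by blast
    then have "t \<in> real_spectrum T"
      by (simp add: mem_real_spectrum_iff poly_op_diff poly_op_X poly_op_const del: diff_pCons)
    then show ?thesis using True by auto
  qed
  with pos \<open>m < 0\<close> show False by force
qed

text \<open>The polynomial c^2 - P^2 is nonnegative on the spectrum, so its operator is positive; as
  P(T) is self-adjoint, this says |P(T) x|^2 \<le> c^2 |x|^2.\<close>

lemma norm_poly_op_le:
  assumes sa: "self_adjoint T" and "0 \<le> c"
    and le: "\<And>t. t \<in> real_spectrum T \<Longrightarrow> \<bar>poly P t\<bar> \<le> c"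
  shows "norm (poly_op P T) \<le> c"
proof (rule norm_blinfun_bound[OF \<open>0 \<le> c\<close>])
  fix x
  have "positive_op (poly_op ([:c\<^sup>2:] - P * P) T)"
  proof (rule positive_op_poly_op[OF sa])
    fix t assume "t \<in> real_spectrum T"
    from power_mono[OF le[OF this], of 2] show "0 \<le> poly ([:c\<^sup>2:] - P * P) t"
      by (simp add: power2_eq_square)
  qed
  then have "inner x (blinfun_apply (poly_op P T) (blinfun_apply (poly_op P T) x)) \<le> c\<^sup>2 * inner x x"
    by (simp add: positive_op_iff poly_op_diff poly_op_mult poly_op_const blinfun.diff_left
        blinfun.scaleR_left inner_diff_right)
  then have "(norm (blinfun_apply (poly_op P T) x))\<^sup>2 \<le> (c * norm x)\<^sup>2"
    by (simp add: power_mult_distrib power2_norm_eq_inner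
        self_adjoint_inner[OF self_adjoint_poly_op[OF sa]])
  then show "norm (blinfun_apply (poly_op P T) x) \<le> c * norm x"
    by (rule power2_le_imp_le) (use \<open>0 \<le> c\<close> in simp)
qed

section \<open>Functional calculus\<close>

lemma uniform_limit_polynomials:
  fixes f :: "real \<Rightarrow> real"
  assumes "compact K" "continuous_on K f"
  obtains P :: "nat \<Rightarrow> real poly" where "uniform_limit K (\<lambda>n t. poly (P n) t) f sequentially"
proof -
  have "\<exists>P :: real poly. \<forall>t\<in>K. \<bar>f t - poly P t\<bar> < 1 / real (Suc n)" for n
  proof -
    obtain g where g: "real_polynomial_function g" "\<And>t. t \<in> K \<Longrightarrow> \<bar>f t - g t\<bar> < 1 / real (Suc n)"
      using Stone_Weierstrass_real_polynomial_function[OF assms, of "1 / real (Suc n)"] by auto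
    then obtain a N where "g = (\<lambda>t. \<Sum>i\<le>N. a i * t ^ i)"
      by (auto simp: real_polynomial_function_iff_sum)
    then have "g t = poly (\<Sum>i\<le>N. monom (a i) i) t" for t
      by (simp add: poly_sum poly_monom)
    with g(2) show ?thesis by metis
  qed
  then obtain P :: "nat \<Rightarrow> real poly"
    where P: "\<And>n t. t \<in> K \<Longrightarrow> \<bar>f t - poly (P n) t\<bar> < 1 / real (Suc n)"
    by metis
  have "uniform_limit K (\<lambda>n t. poly (P n) t) f sequentially"
    unfolding uniform_limit_sequentially_iff
  proof safe
    fix e :: real assume "e > 0"
    then obtain N where N: "1 / real (Suc N) < e" using nat_approx_posE by blast
    have "dist (poly (P n) t) (f t) < e" if "n \<ge> N" "t \<in> K" for n t
    proof -
      have "1 / real (Suc n) \<le> 1 / real (Suc N)" using that by (simp add: frac_le)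
      then show ?thesis using P[OF that(2), of n] N by (simp add: dist_real_def abs_minus_commute)
    qed
    then show "\<exists>N. \<forall>n\<ge>N. \<forall>t\<in>K. dist (poly (P n) t) (f t) < e" by blast
  qed
  then show thesis by (rule that)
qed

text \<open>For t < a the operator T - t is coercive with constant a - t; for t > b its negative is,
  with constant t - b. Either way t is not spectral.\<close>

lemma real_spectrum_subset:
  assumes sa: "self_adjoint T"
    and lower: "\<And>x. a * (norm x)\<^sup>2 \<le> inner x (blinfun_apply T x)"
    and upper: "\<And>x. inner x (blinfun_apply T x) \<le> b * (norm x)\<^sup>2"
  shows "real_spectrum T \<subseteq> {a..b}"
proof
  fix t assume t: "t \<in> real_spectrum T"
  have ops: "T - t *\<^sub>R id_blinfun \<in> bounded_ops"
    using sa by (intro bounded_ops_diff bounded_ops_scaleR) (auto simp: self_adjoint_bounded_ops)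
  have form: "inner x (blinfun_apply (T - t *\<^sub>R id_blinfun) x)
      = inner x (blinfun_apply T x) - t * (norm x)\<^sup>2" for x
    by (simp add: blinfun.diff_left blinfun.scaleR_left inner_diff_right power2_norm_eq_inner)
  have "\<not> t < a"
  proof
    assume "t < a"
    then have "invertible_op (T - t *\<^sub>R id_blinfun)"
      using lower by (intro coercive_invertible[OF ops, of "a - t"]) (auto simp: form algebra_simps)
    with t show False by (simp add: mem_real_spectrum_iff)
  qed
  moreover have "\<not> b < t"
  proof
    assume "b < t"
    have "inner x (blinfun_apply ((-1) *\<^sub>R (T - t *\<^sub>R id_blinfun)) x)
        = t * (norm x)\<^sup>2 - inner x (blinfun_apply T x)" for x
      unfolding blinfun.scaleR_left inner_scaleR_right form by simp
    with upper \<open>b < t\<close> have "invertible_op ((-1) *\<^sub>R (T - t *\<^sub>R id_blinfun))"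
      by (intro coercive_invertible[OF bounded_ops_scaleR[OF ops], of "t - b"])
        (auto simp: left_diff_distrib simp del: scaleR_minus1_left)
    then have "invertible_op ((-1) *\<^sub>R ((-1) *\<^sub>R (T - t *\<^sub>R id_blinfun)))"
      by (rule invertible_op_scaleR) simp
    with t show False by (simp add: mem_real_spectrum_iff)
  qed
  ultimately show "t \<in> {a..b}" by simp
qed

text \<open>Continuity and Weierstrass approximation take place on a compact interval around the
  spectrum; a uniform limit there restricts to the uniform limit on the spectrum that
  \<open>fun_calc\<close> speaks of.\<close>

locale spectral_interval =
  fixes T :: "'h::chilbert_space \<Rightarrow>\<^sub>L 'h" and a b :: real
  assumes sa: "self_adjoint T" and spectrum: "real_spectrum T \<subseteq> {a..b}"
begin

text \<open>With two equal sequences this is the Cauchy property; with two different ones it says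
  that their limits agree.\<close>

lemma poly_op_tendsto_diff:
  assumes P: "uniform_limit (real_spectrum T) (\<lambda>n t. poly (P n) t) f sequentially"
    and Q: "uniform_limit (real_spectrum T) (\<lambda>n t. poly (Q n) t) f sequentially"
  shows "\<forall>e>0. \<exists>N. \<forall>m\<ge>N. \<forall>n\<ge>N. dist (poly_op (P m) T) (poly_op (Q n) T) < e"
proof safe
  fix e :: real assume "e > 0"
  \<comment> \<open>Two errors of e/4 give the non-strict norm bound e/2, which is strictly below
    e.\<close>
  then have "e/4 > 0" by simp
  obtain N1 where N1: "\<And>n t. n \<ge> N1 \<Longrightarrow> t \<in> real_spectrum T \<Longrightarrow> dist (poly (P n) t) (f t) < e/4"
    using P \<open>e/4 > 0\<close> unfolding uniform_limit_sequentially_iff by metis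
  obtain N2 where N2: "\<And>n t. n \<ge> N2 \<Longrightarrow> t \<in> real_spectrum T \<Longrightarrow> dist (poly (Q n) t) (f t) < e/4"
    using Q \<open>e/4 > 0\<close> unfolding uniform_limit_sequentially_iff by metis
  have "dist (poly_op (P m) T) (poly_op (Q n) T) < e" if "m \<ge> max N1 N2" "n \<ge> max N1 N2" for m n
  proof -
    have "norm (poly_op (P m - Q n) T) \<le> e/2"
    proof (rule norm_poly_op_le[OF sa])
      fix t assume "t \<in> real_spectrum T"
      then have "\<bar>poly (P m) t - f t\<bar> < e/4" "\<bar>poly (Q n) t - f t\<bar> < e/4"
        using N1[of m t] N2[of n t] that by (simp_all add: dist_real_def)
      then show "\<bar>poly (P m - Q n) t\<bar> \<le> e/2" unfolding poly_diff by linarith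
    qed (use \<open>e > 0\<close> in simp)
    then show ?thesis using \<open>e > 0\<close> by (simp add: dist_norm poly_op_diff)
  qed
  then show "\<exists>N. \<forall>m\<ge>N. \<forall>n\<ge>N. dist (poly_op (P m) T) (poly_op (Q n) T) < e" by blast
qed

text \<open>Well-definedness of \<open>fun_calc\<close>. One approximating sequence Q on the
  interval provides the limit S, every other admissible sequence has the same limit, and a competing
  value would also have to be the limit along Q.\<close>

lemma fun_calc_limit:
  assumes f: "continuous_on {a..b} f"
    and P: "uniform_limit (real_spectrum T) (\<lambda>n t. poly (P n) t) f sequentially"
  shows "(\<lambda>n. poly_op (P n) T) \<longlonglongrightarrow> fun_calc f T"
proof -
  obtain Q where "uniform_limit {a..b} (\<lambda>n t. poly (Q n) t) f sequentially"
    using uniform_limit_polynomials[OF _ f] by auto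
  then have Q: "uniform_limit (real_spectrum T) (\<lambda>n t. poly (Q n) t) f sequentially"
    by (rule uniform_limit_on_subset[OF _ spectrum])
  have "Cauchy (\<lambda>n. poly_op (Q n) T)"
    using poly_op_tendsto_diff[OF Q Q] by (simp add: Cauchy_def)
  then obtain S where S: "(\<lambda>n. poly_op (Q n) T) \<longlonglongrightarrow> S"
    by (metis Cauchy_convergent_iff convergent_def)
  have lim: "(\<lambda>n. poly_op (P n) T) \<longlonglongrightarrow> S"
    if P: "uniform_limit (real_spectrum T) (\<lambda>n t. poly (P n) t) f sequentially" for P
  proof -
    have "(\<lambda>n. poly_op (P n) T - poly_op (Q n) T) \<longlonglongrightarrow> 0"
      unfolding LIMSEQ_iff using poly_op_tendsto_diff[OF P Q] by (simp add: dist_norm) blast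
    from tendsto_add[OF this S] show ?thesis by simp
  qed
  have "fun_calc f T = S"
    unfolding fun_calc_def real_spectrum_def[symmetric]
  proof (rule the_equality)
    show "S' = S" if "\<forall>P. uniform_limit (real_spectrum T) (\<lambda>n. poly (P n)) f sequentially \<longrightarrow>
        (\<lambda>n. poly_op (P n) T) \<longlonglongrightarrow> S'" for S'
      using that Q S LIMSEQ_unique by blast
  qed (use lim in blast)
  then show ?thesis using lim[OF P] by simp
qed

text \<open>Convergence is recorded on the whole interval, so that approximations of two functions
  can be added and multiplied there.\<close>

lemma fun_calc_approx:
  assumes "continuous_on {a..b} f"
  obtains P where "uniform_limit {a..b} (\<lambda>n t. poly (P n) t) f sequentially"
    and "(\<lambda>n. poly_op (P n) T) \<longlonglongrightarrow> fun_calc f T"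
proof -
  obtain P where P: "uniform_limit {a..b} (\<lambda>n t. poly (P n) t) f sequentially"
    using uniform_limit_polynomials[OF _ assms] by auto
  show thesis
    using P fun_calc_limit[OF assms uniform_limit_on_subset[OF P spectrum]] by (rule that)
qed

lemma fun_calc_eqI:
  assumes "continuous_on {a..b} f"
    and "uniform_limit {a..b} (\<lambda>n t. poly (P n) t) f sequentially"
    and "(\<lambda>n. poly_op (P n) T) \<longlonglongrightarrow> S"
  shows "fun_calc f T = S"
  using fun_calc_limit[OF assms(1) uniform_limit_on_subset[OF assms(2) spectrum]] assms(3)
    LIMSEQ_unique by blast

lemma fun_calc_poly: "fun_calc (\<lambda>t. poly P t) T = poly_op P T"
  by (rule fun_calc_eqI[where P = "\<lambda>_. P"]) (auto intro!: continuous_intros uniform_limit_const)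

lemma fun_calc_const: "fun_calc (\<lambda>_. c) T = c *\<^sub>R id_blinfun"
  using fun_calc_poly[of "[:c:]"] by (simp add: poly_op_const)

lemma fun_calc_ident: "fun_calc (\<lambda>t. t) T = T"
  using fun_calc_poly[of "[:0, 1:]"] by (simp add: poly_op_X)

lemma fun_calc_cong:
  assumes f: "continuous_on {a..b} f" and eq: "\<And>t. t \<in> {a..b} \<Longrightarrow> f t = g t"
  shows "fun_calc f T = fun_calc g T"
proof -
  obtain P where P: "uniform_limit {a..b} (\<lambda>n t. poly (P n) t) f sequentially"
    "(\<lambda>n. poly_op (P n) T) \<longlonglongrightarrow> fun_calc f T"
    using fun_calc_approx[OF f] .
  have "uniform_limit {a..b} (\<lambda>n t. poly (P n) t) g sequentially"
    using P(1) eq unfolding uniform_limit_sequentially_iff by simp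
  moreover have "continuous_on {a..b} g" using f eq by (metis continuous_on_cong)
  ultimately show ?thesis using P(2) fun_calc_eqI by metis
qed

lemma fun_calc_add:
  assumes f: "continuous_on {a..b} f" and g: "continuous_on {a..b} g"
  shows "fun_calc (\<lambda>t. f t + g t) T = fun_calc f T + fun_calc g T"
proof -
  obtain P where P: "uniform_limit {a..b} (\<lambda>n t. poly (P n) t) f sequentially"
    "(\<lambda>n. poly_op (P n) T) \<longlonglongrightarrow> fun_calc f T"
    using fun_calc_approx[OF f] .
  obtain Q where Q: "uniform_limit {a..b} (\<lambda>n t. poly (Q n) t) g sequentially"
    "(\<lambda>n. poly_op (Q n) T) \<longlonglongrightarrow> fun_calc g T"
    using fun_calc_approx[OF g] .
  show ?thesis
    by (rule fun_calc_eqI[where P = "\<lambda>n. P n + Q n"])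
      (use f g uniform_limit_add[OF P(1) Q(1)] tendsto_add[OF P(2) Q(2)]
        in \<open>simp_all add: poly_op_add continuous_on_add\<close>)
qed

lemma fun_calc_mult:
  assumes f: "continuous_on {a..b} f" and g: "continuous_on {a..b} g"
  shows "fun_calc (\<lambda>t. f t * g t) T = fun_calc f T o\<^sub>L fun_calc g T"
proof -
  obtain P where P: "uniform_limit {a..b} (\<lambda>n t. poly (P n) t) f sequentially"
    "(\<lambda>n. poly_op (P n) T) \<longlonglongrightarrow> fun_calc f T"
    using fun_calc_approx[OF f] .
  obtain Q where Q: "uniform_limit {a..b} (\<lambda>n t. poly (Q n) t) g sequentially"
    "(\<lambda>n. poly_op (Q n) T) \<longlonglongrightarrow> fun_calc g T"
    using fun_calc_approx[OF g] .
  \<comment> \<open>Products of uniform limits converge uniformly when the limit functions are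
    bounded; compactness of the interval gives this.\<close>
  have "bounded (f ` {a..b})" "bounded (g ` {a..b})"
    using f g by (simp_all add: compact_continuous_image compact_imp_bounded)
  then show ?thesis
    by (intro fun_calc_eqI[where P = "\<lambda>n. P n * Q n"])
      (use f g uniform_lim_mult[OF P(1) Q(1)]
        bounded_bilinear.tendsto[OF bounded_bilinear_blinfun_compose P(2) Q(2)]
        in \<open>simp_all add: poly_op_mult continuous_on_mult\<close>)
qed

lemma fun_calc_scaleR:
  assumes f: "continuous_on {a..b} f"
  shows "fun_calc (\<lambda>t. c * f t) T = c *\<^sub>R fun_calc f T"
  using fun_calc_mult[OF continuous_on_const f, of c]
  by (simp add: fun_calc_const blinfun_compose_distribs)

lemma fun_calc_diff:
  assumes "continuous_on {a..b} f" "continuous_on {a..b} g"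
  shows "fun_calc (\<lambda>t. f t - g t) T = fun_calc f T - fun_calc g T"
  using fun_calc_add[of f "\<lambda>t. (-1) * g t"] fun_calc_scaleR[of g "-1"] assms
  by (simp add: continuous_on_minus)

lemma self_adjoint_fun_calc:
  assumes "continuous_on {a..b} f"
  shows "self_adjoint (fun_calc f T)"
proof -
  obtain P where "(\<lambda>n. poly_op (P n) T) \<longlonglongrightarrow> fun_calc f T"
    using fun_calc_approx[OF assms] .
  with self_adjoint_poly_op[OF sa] show ?thesis by (rule self_adjoint_limit)
qed

text \<open>With g the square root of f, f(T) is the square of the self-adjoint g(T), so its
  quadratic form at x is |g(T) x|^2.\<close>

lemma positive_op_fun_calc:
  assumes f: "continuous_on {a..b} f" and nonneg: "\<And>t. t \<in> {a..b} \<Longrightarrow> 0 \<le> f t"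
  shows "positive_op (fun_calc f T)"
proof -
  let ?g = "\<lambda>t. sqrt (f t)"
  have g: "continuous_on {a..b} ?g" using f by (rule continuous_on_real_sqrt)
  have "fun_calc f T = fun_calc (\<lambda>t. ?g t * ?g t) T"
    by (rule fun_calc_cong[OF f]) (simp add: nonneg)
  also have "\<dots> = fun_calc ?g T o\<^sub>L fun_calc ?g T" by (rule fun_calc_mult[OF g g])
  finally have "inner x (blinfun_apply (fun_calc f T) x) = (norm (blinfun_apply (fun_calc ?g T) x))\<^sup>2" for x
    by (simp add: self_adjoint_inner[OF self_adjoint_fun_calc[OF g]] power2_norm_eq_inner)
  then show ?thesis
    using self_adjoint_fun_calc[OF f] by (simp add: positive_op_iff)
qed

end

section \<open>The scalar inequality\<close>

text \<open>The left side is the first diagonal Pade approximant of \<open>ln\<close> at 1. Both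
  sides vanish at 1, and the difference has the nonnegative derivative (x - 1)^2 / (x (x +
  1)^2).\<close>

lemma ln_ge_rational:
  fixes t :: real
  assumes "1 \<le> t"
  shows "2 * (t - 1) / (t + 1) \<le> ln t"
proof -
  let ?f = "\<lambda>t::real. ln t - 2 * (t - 1) / (t + 1)"
  have "?f 1 \<le> ?f t"
  proof (rule DERIV_nonneg_imp_nondecreasing[OF assms])
    fix x :: real assume "1 \<le> x"
    then have "(?f has_real_derivative (x - 1)\<^sup>2 / (x * (x + 1)\<^sup>2)) (at x)"
      by (auto intro!: derivative_eq_intros) (simp add: divide_simps, algebra)
    then show "\<exists>y. (?f has_real_derivative y) (at x) \<and> 0 \<le> y"
      using \<open>1 \<le> x\<close> by (intro exI[of _ "(x - 1)\<^sup>2 / (x * (x + 1)\<^sup>2)"]) auto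
  qed
  then show ?thesis by simp
qed

text \<open>Both sides are invariant under t -> 1/t, which reduces the claim to t \<ge> 1.\<close>

lemma ln_square_ge:
  fixes t :: real
  assumes "0 < t"
  shows "4 * (t - 1)\<^sup>2 / (t + 1)\<^sup>2 \<le> (ln t)\<^sup>2"
proof -
  have *: "4 * (s - 1)\<^sup>2 / (s + 1)\<^sup>2 \<le> (ln s)\<^sup>2" if "1 \<le> s" for s :: real
  proof -
    have "(2 * (s - 1) / (s + 1))\<^sup>2 \<le> (ln s)\<^sup>2"
      using that by (intro power_mono ln_ge_rational) auto
    then show ?thesis unfolding power_divide power_mult_distrib by simp
  qed
  show ?thesis
  proof (cases "1 \<le> t")
    case False
    with assms have "4 * (1/t - 1)\<^sup>2 / (1/t + 1)\<^sup>2 = 4 * (t - 1)\<^sup>2 / (t + 1)\<^sup>2"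
      by (simp add: divide_simps power2_eq_square) (simp add: algebra_simps)
    then show ?thesis using *[of "1/t"] assms False by (simp add: ln_div)
  qed (rule *)
qed

lemma powr_minus_1_divide_mono:
  fixes t p q :: real
  assumes "0 < t" "0 < p" "p \<le> q"
  shows "(t powr p - 1) / p \<le> (t powr q - 1) / q"
proof -
  \<comment> \<open>The quotients are chord slopes from 0 of r -> exp (r ln t), and p is the convex
    combination of 0 and q with weight p/q on q.\<close>
  have "exp ((1 - p/q) *\<^sub>R 0 + (p/q) *\<^sub>R (q * ln t)) \<le> (1 - p/q) * exp 0 + (p/q) * exp (q * ln t)"
    using assms by (intro convex_onD[OF exp_convex]) auto
  then have "t powr p \<le> 1 - p/q + p/q * t powr q"
    using assms by (simp add: powr_def)
  then have "(t powr p - 1) / p \<le> (p/q * (t powr q - 1)) / p"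
    using assms by (intro divide_right_mono) (simp_all add: algebra_simps)
  then show ?thesis using assms by simp
qed

text \<open>The harmonic part contributes \<open>(q - p) (t - 1)\<^sup>2 / (D p D q)\<close> with \<open>D p = (1 - p) t + p\<close>,
  and the hypotheses on \<open>p\<close> and \<open>q\<close> are exactly what gives \<open>D \<ge> (t + 1) / 2\<close>.\<close>

lemma scalar_mean_difference_mono:
  fixes t p q :: real
  assumes "0 < t" "0 < p" "p \<le> q" "q \<le> 1"
    and cases: "(1 \<le> t \<and> q \<le> 1/2) \<or> (t \<le> 1 \<and> 1/2 \<le> p)"
  shows "(1/p) * (t powr p - t / ((1 - p) * t + p)) + p * (ln t)\<^sup>2
    \<le> (1/q) * (t powr q - t / ((1 - q) * t + q)) + q * (ln t)\<^sup>2"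
proof -
  define D where "D r = (1 - r) * t + r" for r
  have D: "(t + 1) / 2 \<le> D r" if "r = p \<or> r = q" for r
  proof -
    \<comment> \<open>This product equals D r - (t + 1)/2. Its factors are both nonnegative in the
      first case and both nonpositive in the second.\<close>
    have "0 \<le> (t - 1) * (1/2 - r)"
      using cases that assms by (auto simp: zero_le_mult_iff)
    then show ?thesis by (simp add: D_def field_simps)
  qed
  from D[of p] D[of q] have pos: "D p > 0" "D q > 0" using \<open>0 < t\<close> by simp_all
  \<comment> \<open>From t = D r + r (t - 1): subtracting 1 from both means separates the chord
    slope of the power from a harmonic remainder free of the factor 1/r.\<close>
  have split: "(1/r) * (t powr r - t / D r) = (t powr r - 1) / r - (t - 1) / D r"
    if "r = p \<or> r = q" for r
  proof -
    have "D r > 0" "r > 0" using that pos assms by auto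
    then have "t / D r = 1 + r * ((t - 1) / D r)"
      by (simp add: field_simps) (simp add: D_def algebra_simps)
    then show ?thesis using \<open>r > 0\<close> by (simp add: field_simps)
  qed
  have "(t - 1) / D q - (t - 1) / D p = (q - p) * ((t - 1)\<^sup>2 / (D p * D q))"
  proof -
    have "(t - 1) / D q - (t - 1) / D p = (t - 1) * (D p - D q) / (D p * D q)"
      using pos by (simp add: field_simps)
    also have "D p - D q = (q - p) * (t - 1)" by (simp add: D_def algebra_simps)
    finally show ?thesis by (simp add: power2_eq_square mult_ac)
  qed
  also have "\<dots> \<le> (q - p) * ((t - 1)\<^sup>2 / ((t + 1) / 2 * ((t + 1) / 2)))"
    using D pos assms by (intro mult_left_mono divide_left_mono mult_mono mult_pos_pos) auto
  also have "\<dots> = (q - p) * (4 * (t - 1)\<^sup>2 / (t + 1)\<^sup>2)"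
    by (simp add: power2_eq_square)
  also have "\<dots> \<le> (q - p) * (ln t)\<^sup>2"
    using assms by (intro mult_left_mono ln_square_ge) auto
  finally show ?thesis
    using powr_minus_1_divide_mono[OF assms(1-3)] split[of p] split[of q]
    by (simp add: D_def algebra_simps)
qed

section \<open>Operator means\<close>

locale strictly_positive_pair =
  fixes A B :: "'h::chilbert_space \<Rightarrow>\<^sub>L 'h" and u v :: real
  assumes A: "strictly_positive A" and u_pos: "0 < u"
    and lower: "u *\<^sub>R A \<le>\<^sub>o\<^sub>p B" and upper: "B \<le>\<^sub>o\<^sub>p v *\<^sub>R A"
begin

definition "R = op_powr A (1/2)"
definition "R' = op_powr A (-1/2)"
text \<open>Congruence by \<open>R'\<close> takes the pair A, B to the pair identity,
  \<open>C\<close>; all terms then become functions of one operator.\<close>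

definition "C = R' o\<^sub>L B o\<^sub>L R'"

text \<open>Coercivity puts the spectrum of A in an interval [e, norm A] with e > 0. There the
  powers are continuous and their exponents add, which yields every identity by multiplicativity of
  the calculus.\<close>

lemma
  shows root_self_adjoint: "self_adjoint R" "self_adjoint R'"
    and root_inverse: "R o\<^sub>L R' = id_blinfun" "R' o\<^sub>L R = id_blinfun"
    and root_square: "R o\<^sub>L R = A"
proof -
  have pos: "positive_op A" and "invertible_op A"
    using A by (auto simp: strictly_positive_def)
  then obtain e where e: "0 < e" "\<And>x. e * (norm x)\<^sup>2 \<le> inner x (blinfun_apply A x)"
    using positive_invertible_coercive by blast
  have sa: "self_adjoint A" using pos by (simp add: positive_op_iff)
  have "inner x (blinfun_apply A x) \<le> norm A * (norm x)\<^sup>2" for x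
  proof -
    have "inner x (blinfun_apply A x) \<le> norm x * norm (blinfun_apply A x)"
      by (rule norm_cauchy_schwarz)
    also have "\<dots> \<le> norm x * (norm A * norm x)"
      by (intro mult_left_mono norm_blinfun) simp
    finally show ?thesis by (simp add: power2_eq_square mult_ac)
  qed
  then interpret spectral_interval A e "norm A"
    using sa real_spectrum_subset[OF sa e(2)] by unfold_locales auto
  have cont: "continuous_on {e..norm A} (\<lambda>t. t powr r)" for r
    using e(1) by (intro continuous_intros) auto
  have mult: "op_powr A r o\<^sub>L op_powr A s = fun_calc f A"
    if "\<And>t. t > 0 \<Longrightarrow> t powr (r + s) = f t" for r s f
    unfolding op_powr_def fun_calc_mult[OF cont cont, symmetric]
    using e(1) that
    by (intro fun_calc_cong continuous_on_mult cont) (auto simp: powr_add[symmetric])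
  show "self_adjoint R" "self_adjoint R'"
    unfolding R_def R'_def op_powr_def by (intro self_adjoint_fun_calc cont)+
  show "R o\<^sub>L R' = id_blinfun" "R' o\<^sub>L R = id_blinfun"
    unfolding R_def R'_def
    using mult[of "1/2" "-1/2" "\<lambda>_. 1"] mult[of "-1/2" "1/2" "\<lambda>_. 1"]
    by (simp_all add: fun_calc_const)
  show "R o\<^sub>L R = A"
    unfolding R_def using mult[of "1/2" "1/2" "\<lambda>t. t"] by (simp add: fun_calc_ident)
qed

lemma root_cancel: "R o\<^sub>L (R' o\<^sub>L X) = X" "R' o\<^sub>L (R o\<^sub>L X) = X"
  by (simp_all add: root_inverse flip: blinfun_compose_assoc)

lemma B_eq: "B = R o\<^sub>L C o\<^sub>L R"
  by (simp add: C_def blinfun_compose_assoc root_cancel root_inverse)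

text \<open>The form of \<open>C\<close> at x is the form of B at y = R' x, while the form of A at y
  is |x|^2. The bounds of B by multiples of A thus become bounds of \<open>C\<close> by multiples of
  the identity.\<close>

lemma spectral_interval_C: "spectral_interval C u v"
proof
  have B: "self_adjoint B" using lower by (simp add: op_le_def)
  show C: "self_adjoint C"
    unfolding C_def by (intro self_adjoint_sandwich root_self_adjoint B)
  have form: "inner x (blinfun_apply (R' o\<^sub>L X o\<^sub>L R') x)
      = inner (blinfun_apply R' x) (blinfun_apply X (blinfun_apply R' x))" for X x
    by (simp add: self_adjoint_inner[OF root_self_adjoint(2)])
  have "R' o\<^sub>L A o\<^sub>L R' = R' o\<^sub>L (R o\<^sub>L R) o\<^sub>L R'" by (simp only: root_square)
  also have "\<dots> = id_blinfun" by (simp add: blinfun_compose_assoc root_cancel root_inverse)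
  finally have "R' o\<^sub>L A o\<^sub>L R' = id_blinfun" .
  then have norm: "inner (blinfun_apply R' x) (blinfun_apply A (blinfun_apply R' x)) = (norm x)\<^sup>2" for x
    using form[of x A] by (simp add: power2_norm_eq_inner)
  show "real_spectrum C \<subseteq> {u..v}"
  proof (rule real_spectrum_subset[OF C])
    fix x
    let ?y = "blinfun_apply R' x"
    have "0 \<le> inner ?y (blinfun_apply (B - u *\<^sub>R A) ?y)" "0 \<le> inner ?y (blinfun_apply (v *\<^sub>R A - B) ?y)"
      using lower upper by (simp_all add: op_le_def positive_op_iff)
    then show "u * (norm x)\<^sup>2 \<le> inner x (blinfun_apply C x)" "inner x (blinfun_apply C x) \<le> v * (norm x)\<^sup>2"
      unfolding C_def form
      by (simp_all add: blinfun.diff_left blinfun.scaleR_left inner_diff_right norm)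
  qed
qed

sublocale C: spectral_interval C u v
  by (rule spectral_interval_C)

text \<open>The inverses of A and B are \<open>R' o\<^sub>L R'\<close> and R' C^(-1) R', so their
  weighted sum is R' s(C) R' with s(t) = (1 - p) + p/t. The function in the statement is
  1/s.\<close>

lemma harm_mean_eq:
  assumes "p \<in> {0<..1}"
  shows "harm_mean p A B = R o\<^sub>L fun_calc (\<lambda>t. t / ((1 - p) * t + p)) C o\<^sub>L R"
proof -
  have pos: "(1 - p) * t + p > 0" if "t \<in> {u..v}" for t
    using that assms u_pos by (intro add_nonneg_pos) auto
  let ?h = "\<lambda>t. t / ((1 - p) * t + p)"
  have h: "continuous_on {u..v} ?h"
    using pos by (intro continuous_intros) force+
  have i: "continuous_on {u..v} (\<lambda>t. 1 / t)"
    using u_pos by (intro continuous_intros) auto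
  let ?s = "\<lambda>t. (1 - p) + p * (1 / t)"
  have s: "continuous_on {u..v} ?s" by (intro continuous_intros i)
  have inv: "fun_calc f C o\<^sub>L fun_calc g C = id_blinfun"
    if "continuous_on {u..v} f" "continuous_on {u..v} g" "\<And>t. t \<in> {u..v} \<Longrightarrow> f t * g t = 1" for f g
  proof -
    have "fun_calc (\<lambda>t. f t * g t) C = fun_calc (\<lambda>_. 1) C"
      using that by (intro C.fun_calc_cong continuous_on_mult) auto
    then show ?thesis by (simp add: C.fun_calc_mult that C.fun_calc_const)
  qed
  have sandwich: "inverse_ops (R o\<^sub>L X o\<^sub>L R) (R' o\<^sub>L Y o\<^sub>L R')" "inverse_ops (R' o\<^sub>L Y o\<^sub>L R') (R o\<^sub>L X o\<^sub>L R)"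
    if "X o\<^sub>L Y = id_blinfun" "Y o\<^sub>L X = id_blinfun" "X \<in> bounded_ops" "Y \<in> bounded_ops" for X Y
  proof -
    have "X o\<^sub>L (Y o\<^sub>L Z) = Z" "Y o\<^sub>L (X o\<^sub>L Z) = Z" for Z :: "'h \<Rightarrow>\<^sub>L 'h"
      using that by (simp_all flip: blinfun_compose_assoc)
    then show "inverse_ops (R o\<^sub>L X o\<^sub>L R) (R' o\<^sub>L Y o\<^sub>L R')" "inverse_ops (R' o\<^sub>L Y o\<^sub>L R') (R o\<^sub>L X o\<^sub>L R)"
      using that root_self_adjoint
      by (simp_all add: inverse_ops_def blinfun_compose_assoc root_cancel root_inverse
          bounded_ops_compose self_adjoint_bounded_ops)
  qed
  have ops: "fun_calc f C \<in> bounded_ops" if "continuous_on {u..v} f" for f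
    using that C.self_adjoint_fun_calc self_adjoint_bounded_ops by blast
  \<comment> \<open>The sandwich of the identity is A itself, since the square of \<open>R\<close>
    is A.\<close>
  have "inverse_ops (R o\<^sub>L id_blinfun o\<^sub>L R) (R' o\<^sub>L id_blinfun o\<^sub>L R')"
    by (rule sandwich) simp_all
  then have invA: "op_inv A = R' o\<^sub>L R'"
    by (simp add: root_square op_inv_eqI)
  have C_inv: "fun_calc (\<lambda>t. t) C o\<^sub>L fun_calc (\<lambda>t. 1 / t) C = id_blinfun"
      "fun_calc (\<lambda>t. 1 / t) C o\<^sub>L fun_calc (\<lambda>t. t) C = id_blinfun"
    using u_pos i by (auto intro!: inv)
  have "inverse_ops (R o\<^sub>L fun_calc (\<lambda>t. t) C o\<^sub>L R) (R' o\<^sub>L fun_calc (\<lambda>t. 1 / t) C o\<^sub>L R')"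
    by (intro sandwich C_inv ops i continuous_on_id)
  then have "inverse_ops B (R' o\<^sub>L fun_calc (\<lambda>t. 1 / t) C o\<^sub>L R')"
    by (simp add: C.fun_calc_ident flip: B_eq)
  then have invB: "op_inv B = R' o\<^sub>L fun_calc (\<lambda>t. 1 / t) C o\<^sub>L R'"
    by (rule op_inv_eqI)
  have "fun_calc ?s C = (1 - p) *\<^sub>R id_blinfun + p *\<^sub>R fun_calc (\<lambda>t. 1 / t) C"
    using C.fun_calc_add[OF continuous_on_const continuous_on_mult_left[OF i], of "1 - p" p]
      C.fun_calc_scaleR[OF i, of p] by (simp add: C.fun_calc_const)
  then have sum: "(1 - p) *\<^sub>R op_inv A + p *\<^sub>R op_inv B = R' o\<^sub>L fun_calc ?s C o\<^sub>L R'"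
    by (simp add: invA invB blinfun_compose_distribs)
  have hs: "?h t * ?s t = 1" if "t \<in> {u..v}" for t
  proof -
    have "t > 0" using that u_pos by auto
    then have "?s t = ((1 - p) * t + p) / t" by (simp add: field_simps)
    then show ?thesis using \<open>t > 0\<close> pos[OF that] by simp
  qed
  have sh: "?s t * ?h t = 1" if "t \<in> {u..v}" for t
    using hs[OF that] by (simp only: mult.commute)
  have "inverse_ops (R' o\<^sub>L fun_calc ?s C o\<^sub>L R') (R o\<^sub>L fun_calc ?h C o\<^sub>L R)"
    by (intro sandwich inv ops h s hs sh)
  then show ?thesis unfolding harm_mean_def sum by (rule op_inv_eqI)
qed

text \<open>The geometric and logarithmic terms are sandwiches between two copies of
  \<open>R\<close> by definition, the harmonic one by \<open>harm_mean_eq\<close>; linearity and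
  multiplicativity of the calculus collect them into one function of \<open>C\<close>.\<close>

lemma mean_combination_eq:
  assumes "p \<in> {0<..1}"
  defines "F \<equiv> \<lambda>t. (1/p) * (t powr p - t / ((1 - p) * t + p)) + p * (ln t)\<^sup>2"
  shows "(1/p) *\<^sub>R (geom_mean p A B - harm_mean p A B) + p *\<^sub>R log_square_term A B
    = R o\<^sub>L fun_calc F C o\<^sub>L R" and "continuous_on {u..v} F"
proof -
  have pos: "(1 - p) * t + p > 0" if "t \<in> {u..v}" for t
    using that assms(1) u_pos by (intro add_nonneg_pos) auto
  let ?h = "\<lambda>t. t / ((1 - p) * t + p)"
  have h: "continuous_on {u..v} ?h"
    using pos by (intro continuous_intros) force+
  have g: "continuous_on {u..v} (\<lambda>t. t powr p)" and l: "continuous_on {u..v} ln"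
    using u_pos by (auto intro!: continuous_intros)
  have gh: "continuous_on {u..v} (\<lambda>t. t powr p - ?h t)"
    and l2: "continuous_on {u..v} (\<lambda>t. ln t * ln t)"
    by (intro continuous_on_diff continuous_on_mult g h l)+
  have "fun_calc F C = (1/p) *\<^sub>R (fun_calc (\<lambda>t. t powr p) C - fun_calc ?h C)
      + p *\<^sub>R (fun_calc ln C o\<^sub>L fun_calc ln C)"
    unfolding F_def power2_eq_square
    by (simp only: C.fun_calc_add[OF continuous_on_mult_left[OF gh] continuous_on_mult_left[OF l2]]
        C.fun_calc_scaleR[OF gh] C.fun_calc_scaleR[OF l2] C.fun_calc_diff[OF g h]
        C.fun_calc_mult[OF l l])
  then show "(1/p) *\<^sub>R (geom_mean p A B - harm_mean p A B) + p *\<^sub>R log_square_term A B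
      = R o\<^sub>L fun_calc F C o\<^sub>L R"
    unfolding harm_mean_eq[OF assms(1)] geom_mean_def log_square_term_def Let_def
      op_log_def
      R_def[symmetric] R'_def[symmetric] C_def[symmetric]
    by (simp add: blinfun_compose_distribs op_powr_def[of C])
  show "continuous_on {u..v} F"
    unfolding F_def power2_eq_square
    by (intro continuous_on_add continuous_on_mult_left gh l2)
qed

text \<open>Pointwise order passes to f(C) and g(C) by positivity of the calculus, and congruence by
  the self-adjoint \<open>R\<close> keeps it: the form of R X R at x is the form of X at R
  x.\<close>

lemma sandwich_op_le:
  assumes f: "continuous_on {u..v} f" and g: "continuous_on {u..v} g"
    and le: "\<And>t. t \<in> {u..v} \<Longrightarrow> f t \<le> g t"
  shows "R o\<^sub>L fun_calc f C o\<^sub>L R \<le>\<^sub>o\<^sub>p R o\<^sub>L fun_calc g C o\<^sub>L R"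
proof -
  have sa: "self_adjoint (R o\<^sub>L fun_calc f C o\<^sub>L R)" "self_adjoint (R o\<^sub>L fun_calc g C o\<^sub>L R)"
    by (intro self_adjoint_sandwich root_self_adjoint C.self_adjoint_fun_calc f g)+
  have "positive_op (fun_calc (\<lambda>t. g t - f t) C)"
    using le by (intro C.positive_op_fun_calc continuous_on_diff f g) auto
  then have pos: "0 \<le> inner x (blinfun_apply (fun_calc g C - fun_calc f C) x)" for x
    by (simp add: C.fun_calc_diff[OF g f] positive_op_iff)
  have "0 \<le> inner x (blinfun_apply ((R o\<^sub>L fun_calc g C o\<^sub>L R) - (R o\<^sub>L fun_calc f C o\<^sub>L R)) x)" for x
    using pos[of "blinfun_apply R x"]
    by (simp add: blinfun.diff_left inner_diff_right self_adjoint_inner[OF root_self_adjoint(1), of x])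
  with sa show ?thesis by (simp add: op_le_def positive_op_iff self_adjoint_diff)
qed

end

theorem theorem4p6:
  fixes A B :: "'h::chilbert_space \<Rightarrow>\<^sub>L 'h" and u v p q :: real
  assumes "strictly_positive A" and "strictly_positive B"
    and "0 < u" and "0 < v"
    and "u *\<^sub>R A \<le>\<^sub>o\<^sub>p B" and "B \<le>\<^sub>o\<^sub>p v *\<^sub>R A"
    and "p \<in> {0<..1}" and "q \<in> {0<..1}"
    and "(1 \<le> u \<and> p \<le> q \<and> q \<le> 1/2) \<or> (v \<le> 1 \<and> 1/2 \<le> p \<and> p \<le> q \<and> q \<le> 1)"
  shows "(1/p) *\<^sub>R (geom_mean p A B - harm_mean p A B) + p *\<^sub>R log_square_term A B
    \<le>\<^sub>o\<^sub>p (1/q) *\<^sub>R (geom_mean q A B - harm_mean q A B) + q *\<^sub>R log_square_term A B"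
proof -
  interpret strictly_positive_pair A B u v
    using assms by unfold_locales auto
  show ?thesis
    unfolding mean_combination_eq(1)[OF assms(7)] mean_combination_eq(1)[OF assms(8)]
  proof (intro sandwich_op_le mean_combination_eq(2) assms(7,8) scalar_mean_difference_mono)
    \<comment> \<open>Each alternative places the whole interval on one side of 1: t \<ge> u \<ge> 1
      or t \<le> v \<le> 1.\<close>
    fix t assume "t \<in> {u..v}"
    then show "0 < t" "(1 \<le> t \<and> q \<le> 1/2) \<or> (t \<le> 1 \<and> 1/2 \<le> p)"
      using assms by auto
  qed (use assms in auto)
qed

end
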